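(* Let $k\ge 1$ be an integer. Every deterministic two-party communication protocol $P$ for the Millionaires Problem on $k$-bit inputs has worst-case subjective privacy-approximation ratio at least $2^{k/2}$; that is, no communication protocol for this problem has a worst-case subjective privacy-approximation ratio less than $2^{k/2}$.
   Context: Communication model. Parties $1$ and $2$ hold private inputs $x_1,x_2\in\{0,\ldots,2^k-1\}$ respectively. In a deterministic protocol $P$ the parties exchange bits; the identity of the next sender is determined by the history of bits sent so far, and each bit is a function of the sender's own input and the history. The sequence of all bits sent on input $(x_1,x_2)$ is the transcript. $P$ is a protocol for a function $f$ if the transcript determines $f(x_1,x_2)$ (the last message contains the value of $f$). For an input $(x_1,x_2)$ let $R^P(x_1,x_2)$ be the set of all inputs having the same transcript as $(x_1,x_2)$; it is a combinatorial rectangle (a product set) on which $f$ is constant. Let $R^I(x_1,x_2)=\{(x_1',x_2'): f(x_1',x_2')=f(x_1,x_2)\}$. Subjective ratios. For $i=1$ put $R_1^P(x_1,x_2)=R^P(x_1,x_2)\cap(\{x_1\}\times\{0,\ldots,2^k-1\})$ and $R_1^I(x_1,x_2)=R^I(x_1,x_2)\cap(\{x_1\}\times\{0,\ldots,2^k-1\})$; for $i=2$ put $R_2^P(x_1,x_2)=R^P(x_1,x_2)\cap(\{0,\ldots,2^k-1\}\times\{x_2\})$ and $R_2^I(x_1,x_2)=R^I(x_1,x_2)\cap(\{0,\ldots,2^k-1\}\times\{x_2\})$. The worst-case privacy-approximation ratio (PAR) of $P$ with respect to $i$ is $\max_{(x_1,x_2)} |R_i^I(x_1,x_2)|/|R_i^P(x_1,x_2)|$.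 The worst-case subjective PAR of $P$ is the maximum over $i\in\{1,2\}$ of its worst-case PAR with respect to $i$. Millionaires Problem: $f(x_1,x_2)$ is the identity of the party with the higher value, ties being broken in favor of party $1$; i.e. $f(x_1,x_2)=1$ if $x_1\ge x_2$ and $f(x_1,x_2)=2$ if $x_1<x_2$. *)

theory Defs
  imports Complex_Main
begin

datatype party = Party1 | Party2

definition inputs :: "nat \<Rightarrow> (nat \<times> nat) set" where
  "inputs k = {0..<2 ^ k} \<times> {0..<2 ^ k}"

primrec input_of :: "party \<Rightarrow> nat \<times> nat \<Rightarrow> nat" where
  "input_of Party1 x = fst x"
| "input_of Party2 x = snd x"

text \<open>
  A history is the list of bits sent so far, oldest bit first.  After history \<open>h\<close> the protocol
  has ended if \<open>next_sender P h = None\<close>; otherwise the next sender, holding input \<open>v\<close>, sends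
  \<open>next_bit P h v\<close>.
\<close>

record protocol =
  next_sender :: "bool list \<Rightarrow> party option"
  next_bit :: "bool list \<Rightarrow> nat \<Rightarrow> bool"

definition is_transcript :: "protocol \<Rightarrow> nat \<times> nat \<Rightarrow> bool list \<Rightarrow> bool" where
  "is_transcript P x h \<longleftrightarrow>
     (\<forall>j<length h. \<exists>p. next_sender P (take j h) = Some p \<and>
        h ! j = next_bit P (take j h) (input_of p x)) \<and>
     next_sender P h = None"

lemma is_transcript_unique:
  assumes "is_transcript P x h" "is_transcript P x h'"
  shows "h = h'"
proof -
  have *: "take j h = take j h'" if "j \<le> length h" "j \<le> length h'" for j
    using that
  proof (induction j)
    case 0
    then show ?case by simp
  next
    case (Suc j)
    then have eq: "take j h = take j h'" and lt: "j < length h" "j < length h'"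
      by auto
    then have "h ! j = h' ! j"
      using assms unfolding is_transcript_def by (metis option.inject)
    then show ?case
      using eq lt by (simp add: take_Suc_conv_app_nth)
  qed
  show ?thesis
  proof (cases "length h" "length h'" rule: linorder_cases)
    case less
    then have "h = take (length h) h'" using *[of "length h"] by simp
    then show ?thesis
      using assms less unfolding is_transcript_def by (metis option.distinct(1))
  next
    case equal
    then show ?thesis using *[of "length h"] by simp
  next
    case greater
    then have "h' = take (length h') h" using *[of "length h'"] by simp
    then show ?thesis
      using assms greater unfolding is_transcript_def by (metis option.distinct(1))
  qed
qed

text \<open>
  Meaningful only if \<open>P\<close> terminates on \<open>x\<close>, which \<open>protocol_for\<close> below guarantees for all inputs.
\<close>

definition transcript :: "protocol \<Rightarrow> nat \<times> nat \<Rightarrow> bool list" where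
  "transcript P x = (THE h. is_transcript P x h)"

text \<open>
  The transcript determines the value of \<open>f\<close>.  In particular this covers protocols whose last
  message contains that value, in whatever encoding.
\<close>

definition protocol_for :: "nat \<Rightarrow> (nat \<times> nat \<Rightarrow> 'v) \<Rightarrow> protocol \<Rightarrow> bool" where
  "protocol_for k f P \<longleftrightarrow>
     (\<forall>x\<in>inputs k. \<exists>h. is_transcript P x h) \<and>
     (\<exists>g. \<forall>x\<in>inputs k. f x = g (transcript P x))"

definition RP :: "nat \<Rightarrow> protocol \<Rightarrow> nat \<times> nat \<Rightarrow> (nat \<times> nat) set" where
  "RP k P x = {y \<in> inputs k. transcript P y = transcript P x}"

definition RI :: "nat \<Rightarrow> (nat \<times> nat \<Rightarrow> 'v) \<Rightarrow> nat \<times> nat \<Rightarrow> (nat \<times> nat) set" where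
  "RI k f x = {y \<in> inputs k. f y = f x}"

primrec slice :: "nat \<Rightarrow> party \<Rightarrow> nat \<times> nat \<Rightarrow> (nat \<times> nat) set" where
  "slice k Party1 x = {fst x} \<times> {0..<2 ^ k}"
| "slice k Party2 x = {0..<2 ^ k} \<times> {snd x}"

definition PAR_wrt :: "nat \<Rightarrow> (nat \<times> nat \<Rightarrow> 'v) \<Rightarrow> protocol \<Rightarrow> party \<Rightarrow> real" where
  "PAR_wrt k f P i =
     Max ((\<lambda>x. real (card (RI k f x \<inter> slice k i x)) /
               real (card (RP k P x \<inter> slice k i x))) ` inputs k)"

definition subjective_PAR :: "nat \<Rightarrow> (nat \<times> nat \<Rightarrow> 'v) \<Rightarrow> protocol \<Rightarrow> real" where
  "subjective_PAR k f P = max (PAR_wrt k f P Party1) (PAR_wrt k f P Party2)"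

definition millionaires :: "nat \<times> nat \<Rightarrow> party" where
  "millionaires x = (if fst x \<ge> snd x then Party1 else Party2)"

end

theory Submission
  imports Defs
begin

text \<open>
  Since \<open>0\<close> beats only \<open>0\<close>, the inputs sharing the transcript of \<open>(0, 0)\<close> form a rectangle
  \<open>A \<times> {0}\<close>.  Party 2 sees the ratio \<open>2 ^ k / card A\<close> at \<open>(0, 0)\<close>, whereas party 1 sees the ratio
  \<open>Max A + 1 \<ge> card A\<close> at \<open>(Max A, 0)\<close>.  The product of the two is at least \<open>2 ^ k\<close>.
\<close>

lemma is_transcript_transcript:
  assumes "protocol_for k f P" "x \<in> inputs k"
  shows "is_transcript P x (transcript P x)"
proof -
  obtain h where h: "is_transcript P x h"
    using assms unfolding protocol_for_def by blast
  show ?thesis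
    unfolding transcript_def by (rule theI[of "is_transcript P x", OF h])
      (rule is_transcript_unique[OF _ h])
qed

lemma transcript_eqI: "is_transcript P x h \<Longrightarrow> transcript P x = h"
  unfolding transcript_def by (rule the_equality) (auto dest: is_transcript_unique)

text \<open>After a common prefix of \<open>h\<close> both given inputs have the same sender, whose
  bit depends on one coordinate only. The mixed input shares that coordinate with
  \<open>(x1, x2)\<close> if party 1 sends and with \<open>(y1, y2)\<close> if party 2 sends, so it
  produces the same bit.\<close>

lemma is_transcript_rectangle:
  assumes "is_transcript P (x1, x2) h" "is_transcript P (y1, y2) h"
  shows "is_transcript P (x1, y2) h"
  unfolding is_transcript_def
proof (intro conjI allI impI)
  show "next_sender P h = None"
    using assms unfolding is_transcript_def by blast
next
  fix j assume "j < length h"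
  then obtain p where p: "next_sender P (take j h) = Some p"
      "h ! j = next_bit P (take j h) (input_of p (x1, x2))"
      "h ! j = next_bit P (take j h) (input_of p (y1, y2))"
    using assms unfolding is_transcript_def by (metis option.inject)
  then show "\<exists>p. next_sender P (take j h) = Some p \<and>
      h ! j = next_bit P (take j h) (input_of p (x1, y2))"
    by (cases p) auto
qed

lemma transcript_rectangle:
  assumes "protocol_for k f P" "(x1, x2) \<in> inputs k" "(y1, y2) \<in> inputs k"
    and "transcript P (x1, x2) = transcript P (y1, y2)"
  shows "transcript P (x1, y2) = transcript P (x1, x2)"
  using assms is_transcript_transcript is_transcript_rectangle transcript_eqI by metis

lemma transcript_determines_value:
  assumes "protocol_for k f P" "x \<in> inputs k" "y \<in> inputs k"
    and "transcript P x = transcript P y"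
  shows "f x = f y"
  using assms unfolding protocol_for_def by metis

lemma PAR_wrt_ge:
  assumes "x \<in> inputs k"
  shows "real (card (RI k f x \<inter> slice k i x)) / real (card (RP k P x \<inter> slice k i x))
    \<le> PAR_wrt k f P i"
  unfolding PAR_wrt_def using assms by (intro Max_ge) (auto simp: inputs_def)

theorem theorem4p1:
  fixes k :: nat and P :: protocol
  assumes "k \<ge> 1"
    and "protocol_for k millionaires P"
  shows "subjective_PAR k millionaires P \<ge> 2 powr (real k / 2)"
proof -
  note P = assms(2)
  define A where "A = {x \<in> {0..<2 ^ k}. transcript P (x, 0) = transcript P (0, 0)}"
  define M where "M = Max A"
  have A: "finite A" "0 \<in> A"
    by (auto simp: A_def)
  then have "M \<in> A"
    unfolding M_def by (intro Max_in) auto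
  then have M: "M < 2 ^ k" "transcript P (M, 0) = transcript P (0, 0)"
    by (auto simp: A_def)
  \<comment> \<open>\<open>A\<close> may have gaps below \<open>M\<close>, so only an inequality
    holds.\<close>
  have "card A \<le> card {0..M}"
    using A(1) by (intro card_mono) (auto simp: M_def)
  then have card_A: "card A \<le> M + 1" "0 < card A"
    using A by (auto simp: card_gt_0_iff)

  \<comment> \<open>Against the value 0 party 1 always wins, so the ideal region fills the whole
    slice.\<close>
  have "RI k millionaires (0, 0) \<inter> slice k Party2 (0, 0) = {0..<2 ^ k} \<times> {0}"
    by (auto simp: RI_def inputs_def millionaires_def)
  moreover have "RP k P (0, 0) \<inter> slice k Party2 (0, 0) = A \<times> {0}"
    by (auto simp: RP_def inputs_def A_def)
  ultimately have PAR2: "2 ^ k / real (card A) \<le> PAR_wrt k millionaires P Party2"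
    using PAR_wrt_ge[of "(0, 0)" k millionaires Party2 P]
    by (simp add: inputs_def card_cartesian_product)

  \<comment> \<open>The tie at \<open>(M, M)\<close> goes to party 1, which gives
    \<open>M + 1\<close> points rather than \<open>M\<close>.\<close>
  have "RI k millionaires (M, 0) \<inter> slice k Party1 (M, 0) = {M} \<times> {0..M}"
    using M(1) by (auto simp: RI_def inputs_def millionaires_def split: if_splits)
  moreover have "RP k P (M, 0) \<inter> slice k Party1 (M, 0) = {(M, 0)}"
  proof -
    \<comment> \<open>The transcript of \<open>(M, y)\<close> is also that of \<open>(0, 0)\<close>.
      Mixing these two inputs shows that \<open>(0, y)\<close> has it too, and there party 1 wins
      only for \<open>y = 0\<close>.\<close>
    have "y = 0" if "y < 2 ^ k" "transcript P (M, y) = transcript P (M, 0)" for y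
    proof -
      have "transcript P (0, y) = transcript P (0, 0)"
        using transcript_rectangle[OF P, of 0 0 M y] that M by (simp add: inputs_def)
      then have "millionaires (0, y) = millionaires (0, 0)"
        using transcript_determines_value[OF P, of "(0, y)" "(0, 0)"] that
        by (simp add: inputs_def)
      then show ?thesis
        by (simp add: millionaires_def split: if_splits)
    qed
    then show ?thesis
      using M(1) by (auto simp: RP_def inputs_def)
  qed
  ultimately have "real (M + 1) \<le> PAR_wrt k millionaires P Party1"
    using PAR_wrt_ge[of "(M, 0)" k millionaires Party1 P] M(1)
    by (simp add: inputs_def card_cartesian_product)
  with card_A have PAR1: "real (card A) \<le> PAR_wrt k millionaires P Party1"
    by linarith

  let ?s = "2 powr (real k / 2) :: real"
  have s: "?s * ?s = 2 ^ k"
    by (simp flip: powr_add add: powr_realpow)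
  show ?thesis
  \<comment> \<open>The lower bounds \<open>card A\<close> and \<open>2 ^ k / card A\<close> have
    product \<open>?s * ?s\<close>, so at least one of them reaches \<open>?s\<close>.\<close>
  proof (cases "real (card A) \<ge> ?s")
    case True
    then show ?thesis
      using PAR1 unfolding subjective_PAR_def by linarith
  next
    case False
    then have "?s * real (card A) \<le> ?s * ?s"
      by (intro mult_left_mono) auto
    then have "?s \<le> 2 ^ k / real (card A)"
      unfolding s using card_A(2) by (simp add: pos_le_divide_eq)
    then show ?thesis
      using PAR2 unfolding subjective_PAR_def by linarith
  qed
qed

end
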